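(* Let $x_0\in\mathbb{R}^n$, $a,b>0$, $J_a=[0,a]$, let $B_b(x_0)$ be the closed ball of radius $b$ around $x_0$, and let $f(t,x)\in\mathbb{R}^n$ be a uniformly Lipschitz function of $x$ with constant $K$ and a continuous function of $t$ for all $(t,x)\in J_a\times B_b(x_0)$. Let $M=\max_{(t,x)\in J_a\times B_b(x_0)}\|f(t,x)\|$ and assume $a=b/M$. Let $S\subset\mathbb{R}^n$ be a linear subspace with orthogonal projection matrix $P$, and let $\hat x_0\in S$ satisfy $\|\hat x_0-x_0\|<b/2$. On $J_0=[0,a/2]$ let $x(t)\in B_b(x_0)$ be the solution of $\dot x=f(t,x)$, $x(0)=x_0$, let $\hat x(t)\in B_b(x_0)$ be the solution of the reduced model $\dot{\hat x}=Pf(t,\hat x)$, $\hat x(0)=\hat x_0$, and put $e(t)=\hat x(t)-x(t)$, $e_o(t)=(I-P)e(t)$, $e_i(t)=Pe(t)$. Then the error $e$ in the infinity norm over $J_0$ is bounded by $$\|e\|_\infty\le e^{Ka/2}\,\|e_o\|_\infty+e^{Ka/2}\,\|e_i(0)\|.$$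
   Context: $\|\cdot\|$ is the Euclidean norm on $\mathbb{R}^n$, and for a function $g:J_0\to\mathbb{R}^n$, $\|g\|_\infty=\sup_{t\in J_0}\|g(t)\|$. For a $k$-dimensional subspace $S$ with orthonormal basis given by the columns of $\Phi\in\mathbb{R}^{n\times k}$ ($\Phi^T\Phi=I$), the projection is $P=\Phi\Phi^T$. The reduced solution is $\hat x=\Phi z$, where $\dot z=\Phi^Tf(t,\Phi z)$, so $\hat x(t)\in S$. With $\tilde x(t)=Px(t)$ one has $e_o=\tilde x-x$ and $e_i=\hat x-\tilde x$. "Uniformly Lipschitz with constant $K$" means $\|f(t,x_1)-f(t,x_2)\|\le K\|x_1-x_2\|$ for all $t\in J_a$ and $x_1,x_2\in B_b(x_0)$. In the exponentials, $e$ denotes Euler's number. The solutions $x$ and $\hat x$ exist uniquely in $B_b(x_0)$ on $J_0$ under these assumptions. *)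

theory Defs
  imports "HOL-Analysis.Analysis"
begin

text \<open>
  The matrix \<open>P\<close> is $\Phi\Phi^T$, where the columns of the $n \times k$ matrix $\Phi$ form an
  orthonormal basis of \<open>S\<close>. The columns are the vectors \<open>\<Phi> l\<close> with \<open>l < k\<close>; they are indexed by
  natural numbers rather than by a finite type so that \<open>k = 0\<close>, i.e. \<open>S = {0}\<close>, is covered.
\<close>
definition is_orthogonal_projection_matrix :: "real ^ 'n ^ 'n \<Rightarrow> (real ^ 'n) set \<Rightarrow> bool" where
  "is_orthogonal_projection_matrix P S \<longleftrightarrow>
     (\<exists>(k::nat) (\<Phi> :: nat \<Rightarrow> real ^ 'n).
        (\<forall>l<k. \<forall>m<k. \<Phi> l \<bullet> \<Phi> m = (if l = m then 1 else 0)) \<and>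
        span (\<Phi> ` {..<k}) = S \<and>
        P = (\<chi> i j. \<Sum>l<k. \<Phi> l $ i * \<Phi> l $ j))"

text \<open>
  The derivative is taken within \<open>J\<close>, hence it is one-sided at the end points of an interval \<open>J\<close>.
\<close>
definition is_ivp_solution ::
    "(real \<Rightarrow> 'a \<Rightarrow> 'a) \<Rightarrow> real set \<Rightarrow> 'a set \<Rightarrow> 'a \<Rightarrow> (real \<Rightarrow> 'a::real_normed_vector) \<Rightarrow> bool" where
  "is_ivp_solution g J X y0 y \<longleftrightarrow>
     y 0 = y0 \<and> (\<forall>t\<in>J. y t \<in> X \<and> (y has_vector_derivative g t (y t)) (at t within J))"

definition sup_norm_on :: "real set \<Rightarrow> (real \<Rightarrow> 'a::real_normed_vector) \<Rightarrow> real" where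
  "sup_norm_on J g = (SUP t\<in>J. norm (g t))"

end

theory Submission
  imports Defs
begin

text \<open>
  Since \<open>P\<close> is idempotent, \<open>e_i' = P (f(t, xh) - f(t, x))\<close>, and since \<open>P\<close> is a contraction,
  \<open>\<parallel>e_i'\<parallel> \<le> K \<parallel>e\<parallel> \<le> K (\<parallel>e_i\<parallel> + E)\<close> with \<open>E = \<parallel>e_o\<parallel>\<^sub>\<infinity>\<close>. A Gronwall argument gives
  \<open>\<parallel>e_i(t)\<parallel> + E \<le> exp (K t) (\<parallel>e_i(0)\<parallel> + E)\<close>, and the left-hand side dominates \<open>\<parallel>e(t)\<parallel>\<close>.
\<close>

text \<open>Turns the entrywise matrix into an expansion along the \<open>\<Phi> l\<close>, the form
  in which orthonormality applies.\<close>

lemma matrix_mult_sum_outer: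
  fixes \<Phi> :: "nat \<Rightarrow> real ^ 'n"
  shows "(\<chi> i j. \<Sum>l<k. \<Phi> l $ i * \<Phi> l $ j) *v v = (\<Sum>l<k. (\<Phi> l \<bullet> v) *\<^sub>R \<Phi> l)"
proof (rule vec_eq_iff[THEN iffD2], rule allI)
  fix i
  have "((\<chi> i j. \<Sum>l<k. \<Phi> l $ i * \<Phi> l $ j) *v v) $ i
      = (\<Sum>j\<in>UNIV. \<Sum>l<k. \<Phi> l $ i * \<Phi> l $ j * v $ j)"
    by (simp add: matrix_vector_mult_def sum_distrib_right)
  also have "\<dots> = (\<Sum>l<k. \<Sum>j\<in>UNIV. \<Phi> l $ i * \<Phi> l $ j * v $ j)"
    by (rule sum.swap)
  also have "\<dots> = (\<Sum>l<k. (\<Phi> l \<bullet> v) *\<^sub>R \<Phi> l) $ i"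
    by (simp add: inner_vec_def sum_distrib_left mult.assoc mult.commute mult.left_commute)
  finally show "((\<chi> i j. \<Sum>l<k. \<Phi> l $ i * \<Phi> l $ j) *v v) $ i
      = (\<Sum>l<k. (\<Phi> l \<bullet> v) *\<^sub>R \<Phi> l) $ i" .
qed

text \<open>By orthonormality \<open>P *v v\<close> has the same coefficients
  \<open>\<Phi> l \<bullet> v\<close> as \<open>v\<close>. Expanding again gives idempotence, and
  comparing inner products gives \<open>(P *v v) \<bullet> (P *v v) = (P *v v) \<bullet> v\<close>,
  to which Cauchy-Schwarz applies.\<close>

lemma orthogonal_projection_matrix_props:
  assumes "is_orthogonal_projection_matrix P S"
  shows orthogonal_projection_matrix_idem: "P *v (P *v v) = P *v v"
    and orthogonal_projection_matrix_norm_le: "norm (P *v v) \<le> norm v"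
proof -
  obtain k \<Phi> where ortho: "\<And>l m. l < k \<Longrightarrow> m < k \<Longrightarrow> \<Phi> l \<bullet> \<Phi> m = (if l = m then 1 else 0)"
    and P: "P = (\<chi> i j. \<Sum>l<(k::nat). \<Phi> l $ i * \<Phi> l $ j)"
    using assms unfolding is_orthogonal_projection_matrix_def by blast
  have Pv: "P *v w = (\<Sum>l<k. (\<Phi> l \<bullet> w) *\<^sub>R \<Phi> l)" for w
    unfolding P by (rule matrix_mult_sum_outer)
  have coeff: "\<Phi> l \<bullet> (P *v v) = \<Phi> l \<bullet> v" if "l < k" for l
  proof -
    have "\<Phi> l \<bullet> (P *v v) = (\<Sum>m<k. (\<Phi> m \<bullet> v) * (\<Phi> l \<bullet> \<Phi> m))"
      by (simp add: Pv inner_sum_right)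
    also have "\<dots> = (\<Sum>m<k. if l = m then \<Phi> m \<bullet> v else 0)"
      by (rule sum.cong) (auto simp: ortho that)
    finally show ?thesis using that by simp
  qed
  have "P *v (P *v v) = (\<Sum>l<k. (\<Phi> l \<bullet> (P *v v)) *\<^sub>R \<Phi> l)"
    by (rule Pv)
  also have "\<dots> = (\<Sum>l<k. (\<Phi> l \<bullet> v) *\<^sub>R \<Phi> l)"
    by (rule sum.cong) (simp_all add: coeff)
  finally show "P *v (P *v v) = P *v v"
    by (simp add: Pv)
  have "(P *v v) \<bullet> (P *v v) = (\<Sum>l<k. (\<Phi> l \<bullet> v) * (\<Phi> l \<bullet> (P *v v)))"
    by (subst (1) Pv) (simp add: inner_sum_left)
  also have "\<dots> = (\<Sum>l<k. (\<Phi> l \<bullet> v) * (\<Phi> l \<bullet> v))"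
    by (rule sum.cong) (simp_all add: coeff)
  also have "\<dots> = (P *v v) \<bullet> v"
    by (simp add: Pv inner_sum_left)
  also have "\<dots> \<le> norm (P *v v) * norm v"
    by (rule norm_cauchy_schwarz)
  finally show "norm (P *v v) \<le> norm v"
    \<comment> \<open>One factor \<open>norm (P *v v)\<close> is cancelled; if it vanishes, the
      claim is trivial.\<close>
    by (cases "norm (P *v v) = 0") (auto simp: dot_square_norm power2_eq_square)
qed

text \<open>The constant \<open>E\<close> is kept inside the growing quantity:
  \<open>norm (u t) + E\<close> grows at rate at most \<open>K\<close> times itself, so the
  inequality is homogeneous and a single integrating factor suffices.\<close>

lemma gronwall_norm:
  fixes u u' :: "real \<Rightarrow> 'a::real_inner"
  assumes K: "0 \<le> K" and T: "0 \<le> T"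
    and deriv: "\<And>t. t \<in> {0..T} \<Longrightarrow> (u has_vector_derivative u' t) (at t within {0..T})"
    and bound: "\<And>t. t \<in> {0..T} \<Longrightarrow> norm (u' t) \<le> K * (norm (u t) + E)"
  shows "norm (u T) + E \<le> exp (K * T) * (norm (u 0) + E)"
proof -
  \<comment> \<open>The norm is not differentiable at 0, so it is regularised to \<open>sqrt (\<parallel>u\<parallel>\<^sup>2 + \<epsilon>\<^sup>2)\<close>.\<close>
  have regularised: "norm (u T) + E \<le> exp (K * T) * (norm (u 0) + E) + exp (K * T) * \<epsilon>"
    if \<epsilon>: "\<epsilon> > 0" for \<epsilon>
  proof -
    define v where "v t = sqrt (u t \<bullet> u t + \<epsilon>\<^sup>2)" for t
    \<comment> \<open>The integrating factor turns the growth bound into the claim that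
      \<open>g\<close> does not increase.\<close>
    define g where "g t = (v t + E) * exp (- (K * t))" for t
    have v_pos: "v t > 0" for t
      unfolding v_def using \<epsilon> by (simp add: add_nonneg_pos)
    have norm_le_v: "norm (u t) \<le> v t" for t
      unfolding v_def by (rule real_le_rsqrt) (simp add: dot_square_norm)
    have v_le: "v t \<le> norm (u t) + \<epsilon>" for t
      unfolding v_def using sqrt_add_le_add_sqrt[of "u t \<bullet> u t" "\<epsilon>\<^sup>2"] \<epsilon>
      by (simp add: norm_eq_sqrt_inner)
    define g' where "g' t = (u t \<bullet> u' t / v t - K * (v t + E)) * exp (- (K * t))" for t
    have g_deriv: "(g has_real_derivative g' t) (at t within {0..T})" if t: "t \<in> {0..T}" for t
    proof -
      have pos: "0 < u t \<bullet> u t + \<epsilon>\<^sup>2"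
        using \<epsilon> by (simp add: add_nonneg_pos)
      have "((\<lambda>s. u s \<bullet> u s) has_real_derivative 2 * (u t \<bullet> u' t)) (at t within {0..T})"
        using has_derivative_inner[OF deriv[OF t, unfolded has_vector_derivative_def]
            deriv[OF t, unfolded has_vector_derivative_def]]
        unfolding has_field_derivative_def
        by (rule has_derivative_eq_rhs) (auto simp: inner_commute algebra_simps)
      then have "(v has_real_derivative u t \<bullet> u' t / v t) (at t within {0..T})"
        unfolding v_def using pos
        by (auto intro!: derivative_eq_intros simp: field_simps)
      then show ?thesis
        unfolding g_def g'_def
        by (auto intro!: derivative_eq_intros simp: algebra_simps)
    qed
    have g'_nonpos: "g' t \<le> 0" if t: "t \<in> {0..T}" for t
    proof -
      \<comment> \<open>The derivative of \<open>v\<close> is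
        \<open>u t \<bullet> u' t / v t\<close>. Since \<open>norm (u t) \<le> v t\<close>, it is at
        most \<open>norm (u' t)\<close>, so regularising does not spoil the growth bound.\<close>
      have "u t \<bullet> u' t \<le> norm (u t) * norm (u' t)"
        by (rule norm_cauchy_schwarz)
      also have "\<dots> \<le> v t * norm (u' t)"
        by (intro mult_right_mono norm_le_v) simp
      finally have "u t \<bullet> u' t / v t \<le> norm (u' t)"
        using v_pos[of t] by (simp add: divide_le_eq mult.commute)
      also have "\<dots> \<le> K * (norm (u t) + E)"
        by (rule bound[OF t])
      also have "\<dots> \<le> K * (v t + E)"
        using norm_le_v[of t] K by (intro mult_left_mono) auto
      finally show ?thesis
        unfolding g'_def by (simp add: mult_le_0_iff)
    qed
    have "g T \<le> g 0"
    \<comment> \<open>The derivatives within \<open>{0..T}\<close> are two-sided only in the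
      interior; at the end points continuity is enough.\<close>
    proof (rule DERIV_nonpos_imp_decreasing_open[OF T])
      show "continuous_on {0..T} g"
        using g_deriv DERIV_continuous_on by blast
      fix t assume "0 < t" "t < T"
      then have t: "t \<in> {0..T}" and "at t within {0..T} = at t"
        by (simp_all add: at_within_Icc_at)
      then show "\<exists>y. (g has_real_derivative y) (at t) \<and> y \<le> 0"
        using g_deriv[OF t] g'_nonpos[OF t] by (intro exI[of _ "g' t"]) simp
    qed
    then have "v T + E \<le> exp (K * T) * (v 0 + E)"
      by (simp add: g_def exp_minus field_simps)
    also have "\<dots> \<le> exp (K * T) * (norm (u 0) + \<epsilon> + E)"
      using v_le[of 0] by simp
    finally show ?thesis
      using norm_le_v[of T] by (simp add: algebra_simps)
  qed
  show ?thesis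
  proof (rule field_le_epsilon)
    fix d :: real assume "d > 0"
    then show "norm (u T) + E \<le> exp (K * T) * (norm (u 0) + E) + d"
      \<comment> \<open>This choice of \<epsilon> makes the regularisation error exactly
        \<open>d\<close>.\<close>
      using regularised[of "d / exp (K * T)"] by simp
  qed
qed

theorem lemma2p3:
  fixes x0 xh0 :: "real ^ 'n"
    and a b K M :: real
    and f :: "real \<Rightarrow> real ^ 'n \<Rightarrow> real ^ 'n"
    and S :: "(real ^ 'n) set"
    and P :: "real ^ 'n ^ 'n"
    and x xh e e_o e_i :: "real \<Rightarrow> real ^ 'n"
  assumes a_pos: "a > 0"
    and b_pos: "b > 0"
    and f_lipschitz: "\<And>t. t \<in> {0..a} \<Longrightarrow> K-lipschitz_on (cball x0 b) (f t)"
    and f_continuous: "\<And>y. y \<in> cball x0 b \<Longrightarrow> continuous_on {0..a} (\<lambda>t. f t y)"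
    and M_attained: "\<exists>t\<in>{0..a}. \<exists>y\<in>cball x0 b. norm (f t y) = M"
    and M_upper: "\<And>t y. t \<in> {0..a} \<Longrightarrow> y \<in> cball x0 b \<Longrightarrow> norm (f t y) \<le> M"
    and a_eq: "a = b / M"
    and S_subspace: "subspace S"
    and P_projection: "is_orthogonal_projection_matrix P S"
    and xh0_in_S: "xh0 \<in> S"
    and xh0_near: "norm (xh0 - x0) < b / 2"
    and x_solution: "is_ivp_solution f {0..a/2} (cball x0 b) x0 x"
    and xh_solution: "is_ivp_solution (\<lambda>t y. P *v f t y) {0..a/2} (cball x0 b) xh0 xh"
    and e_eq: "e = (\<lambda>t. xh t - x t)"
    and e_o_eq: "e_o = (\<lambda>t. (mat 1 - P) *v e t)"
    and e_i_eq: "e_i = (\<lambda>t. P *v e t)"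
  shows "sup_norm_on {0..a/2} e
           \<le> exp (K * a / 2) * sup_norm_on {0..a/2} e_o + exp (K * a / 2) * norm (e_i 0)"
proof -
  define J where "J = {0..a/2}"
  define E where "E = sup_norm_on J e_o"
  have K: "0 \<le> K"
    using f_lipschitz[of 0] a_pos lipschitz_on_nonneg by force
  have x: "x t \<in> cball x0 b" "(x has_vector_derivative f t (x t)) (at t within J)"
    and xh: "xh t \<in> cball x0 b" "(xh has_vector_derivative P *v f t (xh t)) (at t within J)"
    if "t \<in> J" for t
    using x_solution xh_solution that unfolding is_ivp_solution_def J_def by blast+
  have e_deriv: "(e has_vector_derivative P *v f t (xh t) - f t (x t)) (at t within J)"
    if "t \<in> J" for t
    unfolding e_eq by (intro has_vector_derivative_diff x xh that)
  \<comment> \<open>A real supremum is known to dominate the values only when they are bounded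
    above; continuity on the compact interval \<open>J\<close> provides this for
    \<open>e_o\<close>.\<close>
  have "continuous_on J e"
    by (rule continuous_on_vector_derivative) (rule e_deriv)
  then have "continuous_on J e_o"
    unfolding e_o_eq by (rule bounded_linear.continuous_on[OF matrix_vector_mul_bounded_linear])
  then have "bounded (e_o ` J)"
    unfolding J_def by (intro compact_imp_bounded compact_continuous_image) auto
  then have bdd: "bdd_above ((\<lambda>t. norm (e_o t)) ` J)"
    by (auto simp: bounded_iff bdd_above_def)
  have e_o_le: "norm (e_o t) \<le> E" if "t \<in> J" for t
    unfolding E_def sup_norm_on_def by (rule cSUP_upper[OF that bdd])
  have J0: "0 \<in> J"
    using a_pos by (simp add: J_def)
  have E: "0 \<le> E"
    using e_o_le[OF J0] norm_ge_zero order_trans by blast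
  have "e t = e_i t + e_o t" for t
    by (simp add: e_i_eq e_o_eq matrix_vector_mult_diff_rdistrib)
  then have e_le: "norm (e t) \<le> norm (e_i t) + E" if "t \<in> J" for t
    using norm_triangle_ineq[of "e_i t" "e_o t"] e_o_le[OF that] by simp
  have e_i_deriv: "(e_i has_vector_derivative P *v (f t (xh t) - f t (x t))) (at t within J)"
    if "t \<in> J" for t
  proof -
    have "(e_i has_vector_derivative P *v (P *v f t (xh t) - f t (x t))) (at t within J)"
      unfolding e_i_eq
      by (rule bounded_linear.has_vector_derivative[OF matrix_vector_mul_bounded_linear e_deriv[OF that]])
    then show ?thesis
      by (simp add: matrix_vector_mult_diff_distrib orthogonal_projection_matrix_idem[OF P_projection])
  qed
  have e_i_deriv_le: "norm (P *v (f t (xh t) - f t (x t))) \<le> K * (norm (e_i t) + E)"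
    if t: "t \<in> J" for t
  proof -
    have "norm (P *v (f t (xh t) - f t (x t))) \<le> norm (f t (xh t) - f t (x t))"
      by (rule orthogonal_projection_matrix_norm_le[OF P_projection])
    also have "\<dots> \<le> K * norm (e t)"
      using lipschitz_onD[OF f_lipschitz xh(1)[OF t] x(1)[OF t]] t
      by (simp add: dist_norm e_eq J_def)
    also have "\<dots> \<le> K * (norm (e_i t) + E)"
      by (rule mult_left_mono[OF e_le[OF t] K])
    finally show ?thesis .
  qed
  have e_bound: "norm (e t) \<le> exp (K * a / 2) * (norm (e_i 0) + E)" if t: "t \<in> J" for t
  proof -
    \<comment> \<open>\<open>gronwall_norm\<close> bounds only the value at the right end point, so
      it is applied on \<open>{0..t}\<close> for each \<open>t\<close>, with the derivatives
      restricted from \<open>J\<close>.\<close>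
    have sub: "{0..t} \<subseteq> J"
      using t by (auto simp: J_def)
    have "norm (e t) \<le> norm (e_i t) + E"
      by (rule e_le[OF t])
    also have "\<dots> \<le> exp (K * t) * (norm (e_i 0) + E)"
    proof (rule gronwall_norm[OF K])
      show "0 \<le> t" using t by (simp add: J_def)
      show "(e_i has_vector_derivative P *v (f s (xh s) - f s (x s))) (at s within {0..t})"
        if "s \<in> {0..t}" for s
        using e_i_deriv sub that by (blast intro: has_vector_derivative_within_subset)
      show "norm (P *v (f s (xh s) - f s (x s))) \<le> K * (norm (e_i s) + E)" if "s \<in> {0..t}" for s
        using e_i_deriv_le sub that by blast
    qed
    \<comment> \<open>As \<open>t \<le> a / 2\<close> and \<open>K\<close>, \<open>E\<close> are
      nonnegative, the bound becomes uniform in \<open>t\<close> and passes to the supremum.\<close>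
    also have "\<dots> \<le> exp (K * a / 2) * (norm (e_i 0) + E)"
      using t K E mult_left_mono[of t "a / 2" K] by (intro mult_right_mono) (auto simp: J_def)
    finally show ?thesis .
  qed
  have "sup_norm_on J e \<le> exp (K * a / 2) * (norm (e_i 0) + E)"
    unfolding sup_norm_on_def using J0 e_bound by (intro cSUP_least) auto
  then show ?thesis
    by (simp add: E_def J_def algebra_simps)
qed

end
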